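(* Let $n,d,l,d',d''\ge1$ be integers, and let $M:\mathbb{R}^d\times\mathbb{R}^d\times\mathbb{R}^l\to\mathbb{R}^{d'}$ and $U:\mathbb{R}^d\times\mathbb{R}^{d'}\to\mathbb{R}^{d''}$ be continuous. Consider the message passing layer defined by $M$ and $U$, which maps node features $H=(h_u)\in\mathbb{R}^{n\times d}$ on a graph with adjacency matrix $A\in\{0,1\}^{n\times n}$ and edge features $E=(e_{uv})\in\mathbb{R}^{n\times n\times l}$ to new node features $H'=(h'_u)\in\mathbb{R}^{n\times d''}$. Then for every compact set $K\subset\mathbb{R}^{n\times d}\times\mathbb{R}^{n\times n\times l}$ and every $\varepsilon>0$ there exists an order-2 equivariant graph network $F:\mathbb{R}^{n\times n\times(1+l+d)}\to\mathbb{R}^{n\times n\times(1+l+d'')}$ such that for all $(H,E)\in K$ and all $A\in\{0,1\}^{n\times n}$, $$\big\|F(\mathcal{Y}(A,E,H))-\mathcal{Y}(A,E,H')\big\|_\infty\le\varepsilon .$$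
   Context: Message passing layer: for $u\in[n]=\{1,\dots,n\}$, with $N(u)=\{v\in[n]: a_{uv}=1\}$, $$m_u=\sum_{v\in N(u)}M(h_u,h_v,e_{uv}),\qquad h'_u=U(h_u,m_u).$$ Encoding: for $A=(a_{uv})\in\{0,1\}^{n\times n}$, $E=(e_{uv})\in\mathbb{R}^{n\times n\times l}$ and $H=(h_u)\in\mathbb{R}^{n\times c}$, $\mathcal{Y}(A,E,H)\in\mathbb{R}^{n\times n\times(1+l+c)}$ is the tensor whose $(u,v)$ feature vector is $[a_{uv},e_{uv},\delta_{uv}h_u]$ ($\delta_{uv}$ the Kronecker delta): first channel the adjacency matrix, next $l$ channels the edge features, last $c$ channels diagonal matrices holding the node features. Model: an order-2 equivariant linear layer is an affine map $L:\mathbb{R}^{n\times n\times c}\to\mathbb{R}^{n\times n\times c'}$ with $L(P\star X)=P\star L(X)$ for all $X$ and all $n\times n$ permutation matrices $P$, where, for $p$ the permutation of $P$, the $(p(i),p(j),s)$-th entry of $P\star X$ equals the $(i,j,s)$-th entry of $X$. An order-2 equivariant graph network is a composition $L_r\circ\sigma\circ L_{r-1}\circ\cdots\circ\sigma\circ L_1$ of such layers (any number $r\geq 1$ of layers, any numbers of intermediate feature channels), where $\sigma$ is the entrywise ReLU $\sigma(x)=\max(x,0)$. $\|\cdot\|_\infty$ is the maximum absolute entry. *)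

theory Defs
  imports "HOL-Analysis.Analysis" "HOL-Combinatorics.Permutations"
begin

text \<open>
  The numbers of nodes and channels are natural numbers (the channel numbers are
  quantified over inside the definition of a network), so arrays are functions on
  indices counted from 0 and vanishing outside their index range. The
  function types carry the product topology, which on these carriers is the usual
  Euclidean one; cf. \<open>subtopology_vecs\<close> below. Hence
  \<open>continuous_on\<close> and \<open>compact\<close> have their usual meaning on them.
\<close>

definition vecs :: "nat \<Rightarrow> (nat \<Rightarrow> real) set" where
  "vecs d = {x. \<forall>i\<ge>d. x i = 0}"

definition mats :: "nat \<Rightarrow> nat \<Rightarrow> (nat \<Rightarrow> nat \<Rightarrow> real) set" where
  "mats n d = {X. \<forall>i s. \<not> (i < n \<and> s < d) \<longrightarrow> X i s = 0}"

definition tensors :: "nat \<Rightarrow> nat \<Rightarrow> (nat \<Rightarrow> nat \<Rightarrow> nat \<Rightarrow> real) set" where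
  "tensors n c = {X. \<forall>i j s. \<not> (i < n \<and> j < n \<and> s < c) \<longrightarrow> X i j s = 0}"

lemma subtopology_vecs: "subtopology euclidean (vecs d) = Euclidean_space d"
  by (simp add: vecs_def Euclidean_space_def euclidean_product_topology)

definition max_norm :: "nat \<Rightarrow> nat \<Rightarrow> (nat \<Rightarrow> nat \<Rightarrow> nat \<Rightarrow> real) \<Rightarrow> real" where
  "max_norm n c X = Max ((\<lambda>(i, j, s). \<bar>X i j s\<bar>) ` ({..<n} \<times> {..<n} \<times> {..<c}))"

definition nbrs :: "nat \<Rightarrow> (nat \<Rightarrow> nat \<Rightarrow> real) \<Rightarrow> nat \<Rightarrow> nat set" where
  "nbrs n A u = {v. v < n \<and> A u v = 1}"

definition message ::
  "nat \<Rightarrow> ((nat \<Rightarrow> real) \<times> (nat \<Rightarrow> real) \<times> (nat \<Rightarrow> real) \<Rightarrow> (nat \<Rightarrow> real)) \<Rightarrow>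
   (nat \<Rightarrow> nat \<Rightarrow> real) \<Rightarrow> (nat \<Rightarrow> nat \<Rightarrow> nat \<Rightarrow> real) \<Rightarrow> (nat \<Rightarrow> nat \<Rightarrow> real) \<Rightarrow>
   nat \<Rightarrow> (nat \<Rightarrow> real)" where
  "message n M A E H u = (\<lambda>k. \<Sum>v\<in>nbrs n A u. M (H u, H v, E u v) k)"

definition mp_layer ::
  "nat \<Rightarrow> ((nat \<Rightarrow> real) \<times> (nat \<Rightarrow> real) \<times> (nat \<Rightarrow> real) \<Rightarrow> (nat \<Rightarrow> real)) \<Rightarrow>
   ((nat \<Rightarrow> real) \<times> (nat \<Rightarrow> real) \<Rightarrow> (nat \<Rightarrow> real)) \<Rightarrow>
   (nat \<Rightarrow> nat \<Rightarrow> real) \<Rightarrow> (nat \<Rightarrow> nat \<Rightarrow> nat \<Rightarrow> real) \<Rightarrow> (nat \<Rightarrow> nat \<Rightarrow> real) \<Rightarrow>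
   (nat \<Rightarrow> nat \<Rightarrow> real)" where
  "mp_layer n M U A E H =
     (\<lambda>u. if u < n then U (H u, message n M A E H u) else (\<lambda>k. 0))"

definition encoding ::
  "nat \<Rightarrow> nat \<Rightarrow> nat \<Rightarrow> (nat \<Rightarrow> nat \<Rightarrow> real) \<Rightarrow> (nat \<Rightarrow> nat \<Rightarrow> nat \<Rightarrow> real) \<Rightarrow>
   (nat \<Rightarrow> nat \<Rightarrow> real) \<Rightarrow> (nat \<Rightarrow> nat \<Rightarrow> nat \<Rightarrow> real)" where
  "encoding n l c A E H = (\<lambda>u v s.
     if u < n \<and> v < n \<and> s < 1 + l + c then
       if s = 0 then A u v
       else if s < 1 + l then E u v (s - 1)
       else if u = v then H u (s - (1 + l))
       else 0
     else 0)"

text \<open>For \<open>p\<close> permuting the nodes, entry \<open>(p i, p j, s)\<close> of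
  \<open>perm_action p X\<close> is entry \<open>(i, j, s)\<close> of \<open>X\<close>.\<close>

definition perm_action ::
  "(nat \<Rightarrow> nat) \<Rightarrow> (nat \<Rightarrow> nat \<Rightarrow> nat \<Rightarrow> real) \<Rightarrow> (nat \<Rightarrow> nat \<Rightarrow> nat \<Rightarrow> real)" where
  "perm_action p X = (\<lambda>i j s. X (inv p i) (inv p j) s)"

definition linear_tensor_map ::
  "nat \<Rightarrow> nat \<Rightarrow> nat \<Rightarrow> ((nat \<Rightarrow> nat \<Rightarrow> nat \<Rightarrow> real) \<Rightarrow> (nat \<Rightarrow> nat \<Rightarrow> nat \<Rightarrow> real)) \<Rightarrow> bool" where
  "linear_tensor_map n c c' T \<longleftrightarrow>
     T \<in> tensors n c \<rightarrow> tensors n c' \<and>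
     (\<forall>X\<in>tensors n c. \<forall>Y\<in>tensors n c.
        T (\<lambda>i j s. X i j s + Y i j s) = (\<lambda>i j s. T X i j s + T Y i j s)) \<and>
     (\<forall>a. \<forall>X\<in>tensors n c. T (\<lambda>i j s. a * X i j s) = (\<lambda>i j s. a * T X i j s))"

definition affine_tensor_map ::
  "nat \<Rightarrow> nat \<Rightarrow> nat \<Rightarrow> ((nat \<Rightarrow> nat \<Rightarrow> nat \<Rightarrow> real) \<Rightarrow> (nat \<Rightarrow> nat \<Rightarrow> nat \<Rightarrow> real)) \<Rightarrow> bool" where
  "affine_tensor_map n c c' L \<longleftrightarrow>
     (\<exists>T. \<exists>B\<in>tensors n c'. linear_tensor_map n c c' T \<and>
        (\<forall>X\<in>tensors n c. L X = (\<lambda>i j s. T X i j s + B i j s)))"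

definition equivariant_layer ::
  "nat \<Rightarrow> nat \<Rightarrow> nat \<Rightarrow> ((nat \<Rightarrow> nat \<Rightarrow> nat \<Rightarrow> real) \<Rightarrow> (nat \<Rightarrow> nat \<Rightarrow> nat \<Rightarrow> real)) \<Rightarrow> bool" where
  "equivariant_layer n c c' L \<longleftrightarrow>
     affine_tensor_map n c c' L \<and>
     (\<forall>p X. p permutes {..<n} \<longrightarrow> X \<in> tensors n c \<longrightarrow>
        L (perm_action p X) = perm_action p (L X))"

definition relu :: "(nat \<Rightarrow> nat \<Rightarrow> nat \<Rightarrow> real) \<Rightarrow> (nat \<Rightarrow> nat \<Rightarrow> nat \<Rightarrow> real)" where
  "relu X = (\<lambda>i j s. max (X i j s) 0)"

inductive equivariant_network ::
  "nat \<Rightarrow> nat \<Rightarrow> nat \<Rightarrow> ((nat \<Rightarrow> nat \<Rightarrow> nat \<Rightarrow> real) \<Rightarrow> (nat \<Rightarrow> nat \<Rightarrow> nat \<Rightarrow> real)) \<Rightarrow> bool"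
  for n c where
  single: "equivariant_layer n c c' L \<Longrightarrow> equivariant_network n c c' L"
| comp: "equivariant_network n c b F \<Longrightarrow> b \<ge> 1 \<Longrightarrow> equivariant_layer n b c' L \<Longrightarrow>
    equivariant_network n c c' (L \<circ> relu \<circ> F)"

end

theory Submission
  imports Defs
begin

text \<open>
  A network can keep all its channels while computing one further channel, since
  \<open>x = max x 0 - max (- x) 0\<close>. Hence the functions of an instance and a pair of nodes that
  can be computed as one channel contain the inputs and are closed under linear combinations, ReLU
  and row sums; in particular under maxima and absolute values. The uniform limits of such functions
  have the same closure properties and, because a continuous function on a compact set is a uniform
  limit of maxima of finitely many cones \<open>f y - L * \<rho> x y\<close> with \<open>\<rho>\<close> the \<open>l\<^sup>1\<close>-distance, they
  are also closed under continuous functions. Applying \<open>M\<close> to the features of a pair of nodes,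
  multiplying by the adjacency entry, summing over rows and applying \<open>U\<close> therefore stays within
  these limits, so no error propagation has to be tracked. A last layer restricts the result to the
  diagonal and copies the channels of \<open>A\<close> and \<open>E\<close>, which were kept exactly.
\<close>

section \<open>Equivariant layers\<close>

text \<open>An equivariant linear map with one output channel. It acts on arbitrary arrays and is
  not cut off at the index range; \<open>affine_layer\<close> does the cut-off.\<close>

definition equivariant_linear ::
  "nat \<Rightarrow> ((nat \<Rightarrow> nat \<Rightarrow> nat \<Rightarrow> real) \<Rightarrow> nat \<Rightarrow> nat \<Rightarrow> real) \<Rightarrow> bool" where
  "equivariant_linear n G \<longleftrightarrow>
     (\<forall>X Y i j. G (\<lambda>i j s. X i j s + Y i j s) i j = G X i j + G Y i j) \<and>
     (\<forall>a X i j. G (\<lambda>i j s. a * X i j s) i j = a * G X i j) \<and>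
     (\<forall>p X i j. p permutes {..<n} \<longrightarrow>
        G (perm_action p X) i j = G X (inv p i) (inv p j))"

section \<open>Elementary equivariant linear maps with one output channel\<close>

lemma equivariant_linear_zero: "equivariant_linear n (\<lambda>X i j. 0)"
  by (simp add: equivariant_linear_def)

lemma equivariant_linear_entry: "equivariant_linear n (\<lambda>X i j. X i j t)"
  by (simp add: equivariant_linear_def perm_action_def)

lemma equivariant_linear_row_node: "equivariant_linear n (\<lambda>X i j. X i i t)"
  by (simp add: equivariant_linear_def perm_action_def)

lemma equivariant_linear_column_node: "equivariant_linear n (\<lambda>X i j. X j j t)"
  by (simp add: equivariant_linear_def perm_action_def)

text \<open>Rows and columns are permuted by the same injective map, so the diagonal is
  preserved.\<close>

lemma equivariant_linear_diagonal:
  "equivariant_linear n (\<lambda>X i j. if i = j then X i j t else 0)"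
proof -
  have "inv p i = inv p j \<longleftrightarrow> i = j" if "p permutes {..<n}" for p :: "nat \<Rightarrow> nat" and i j
    using permutes_inj[OF permutes_inv[OF that]] by (auto dest: injD)
  then show ?thesis
    by (auto simp: equivariant_linear_def perm_action_def)
qed

text \<open>Reindexing the sum by the permutation absorbs its action on the column index.\<close>

lemma equivariant_linear_row_sum: "equivariant_linear n (\<lambda>X i j. \<Sum>k<n. X i k t)"
proof -
  have "(\<Sum>k<n. X (inv p i) (inv p k) t) = (\<Sum>k<n. X (inv p i) k t)"
    if "p permutes {..<n}" for p i and X :: "nat \<Rightarrow> nat \<Rightarrow> nat \<Rightarrow> real"
    using sum.permute[OF permutes_inv[OF that], of "\<lambda>k. X (inv p i) k t"] by (simp add: o_def)
  then show ?thesis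
    by (simp add: equivariant_linear_def perm_action_def sum.distrib sum_distrib_left)
qed

lemma equivariant_linear_add:
  "equivariant_linear n G \<Longrightarrow> equivariant_linear n G' \<Longrightarrow>
    equivariant_linear n (\<lambda>X i j. G X i j + G' X i j)"
  by (simp add: equivariant_linear_def algebra_simps)

lemma equivariant_linear_scale:
  "equivariant_linear n G \<Longrightarrow> equivariant_linear n (\<lambda>X i j. a * G X i j)"
  by (simp add: equivariant_linear_def algebra_simps)

text \<open>The bias is one constant per channel, hence invariant under permutations of the nodes;
  the cut-off puts the result into \<open>tensors n c'\<close>.\<close>

definition affine_layer ::
  "nat \<Rightarrow> nat \<Rightarrow> (nat \<Rightarrow> real) \<Rightarrow>
   (nat \<Rightarrow> (nat \<Rightarrow> nat \<Rightarrow> nat \<Rightarrow> real) \<Rightarrow> nat \<Rightarrow> nat \<Rightarrow> real) \<Rightarrow>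
   (nat \<Rightarrow> nat \<Rightarrow> nat \<Rightarrow> real) \<Rightarrow> (nat \<Rightarrow> nat \<Rightarrow> nat \<Rightarrow> real)" where
  "affine_layer n c' \<beta> G X =
     (\<lambda>i j s. if i < n \<and> j < n \<and> s < c' then \<beta> s + G s X i j else 0)"

lemma equivariant_layer_affine_layer:
  assumes "\<And>s. s < c' \<Longrightarrow> equivariant_linear n (G s)"
  shows "equivariant_layer n c c' (affine_layer n c' \<beta> G)"
proof -
  \<comment> \<open>The linear part is the layer with zero bias, the constant part the layer with
    \<open>G\<close> replaced by zero.\<close>
  have "linear_tensor_map n c c' (affine_layer n c' (\<lambda>s. 0) G)"
    using assms unfolding linear_tensor_map_def affine_layer_def equivariant_linear_def
    by (auto simp: tensors_def fun_eq_iff)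
  moreover have "affine_layer n c' \<beta> (\<lambda>s X i j. 0) (\<lambda>i j s. 0) \<in> tensors n c'"
    by (auto simp: tensors_def affine_layer_def)
  moreover have "affine_layer n c' \<beta> G X =
      (\<lambda>i j s. affine_layer n c' (\<lambda>s. 0) G X i j s
        + affine_layer n c' \<beta> (\<lambda>s X i j. 0) (\<lambda>i j s. 0) i j s)" for X
    by (auto simp: affine_layer_def fun_eq_iff)
  ultimately have "affine_tensor_map n c c' (affine_layer n c' \<beta> G)"
    unfolding affine_tensor_map_def by blast
  moreover have "affine_layer n c' \<beta> G (perm_action p X) = perm_action p (affine_layer n c' \<beta> G X)"
    if p: "p permutes {..<n}" for p X
  proof -
    \<comment> \<open>The nodes are permuted among themselves, so the cut-off commutes with the
      action.\<close>
    have "inv p i < n \<longleftrightarrow> i < n" for i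
      using permutes_in_image[OF permutes_inv[OF p]] by simp
    moreover have "G s (perm_action p X) i j = G s X (inv p i) (inv p j)" if "s < c'" for s i j
      using assms[OF that] p by (auto simp: equivariant_linear_def)
    ultimately show ?thesis
      unfolding affine_layer_def perm_action_def[of p "\<lambda>i j s. if _ i j s then _ i j s else _"]
      by (intro ext) (simp add: perm_action_def)
  qed
  ultimately show ?thesis
    by (simp add: equivariant_layer_def)
qed

text \<open>The linear parts compose and the new constant is \<open>T' B + B'\<close>. This merges
  two layers with no ReLU between them.\<close>

lemma equivariant_layer_comp:
  assumes "equivariant_layer n c b L" "equivariant_layer n b c' L'"
  shows "equivariant_layer n c c' (L' \<circ> L)"
proof -
  obtain T B where B: "B \<in> tensors n b" and T: "linear_tensor_map n c b T"
    and L: "\<And>X. X \<in> tensors n c \<Longrightarrow> L X = (\<lambda>i j s. T X i j s + B i j s)"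
    using assms(1) unfolding equivariant_layer_def affine_tensor_map_def by blast
  obtain T' B' where B': "B' \<in> tensors n c'" and T': "linear_tensor_map n b c' T'"
    and L': "\<And>X. X \<in> tensors n b \<Longrightarrow> L' X = (\<lambda>i j s. T' X i j s + B' i j s)"
    using assms(2) unfolding equivariant_layer_def affine_tensor_map_def by blast
  have TX: "T X \<in> tensors n b" if "X \<in> tensors n c" for X
    using T that by (auto simp: linear_tensor_map_def)
  have LX: "L X \<in> tensors n b" if "X \<in> tensors n c" for X
    using TX[OF that] B unfolding L[OF that] by (simp add: tensors_def)
  have "linear_tensor_map n c c' (T' \<circ> T)"
    using T T' TX unfolding linear_tensor_map_def by (auto simp: Pi_iff)
  moreover have "(\<lambda>i j s. T' B i j s + B' i j s) \<in> tensors n c'"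
    using T' B B' unfolding linear_tensor_map_def by (auto simp: Pi_iff tensors_def)
  moreover have "(L' \<circ> L) X = (\<lambda>i j s. (T' \<circ> T) X i j s + (T' B i j s + B' i j s))"
    if X: "X \<in> tensors n c" for X
  proof -
    have "T' (L X) = (\<lambda>i j s. T' (T X) i j s + T' B i j s)"
      using T' TX[OF X] B unfolding L[OF X] linear_tensor_map_def by blast
    then show ?thesis
      using L'[OF LX[OF X]] by (simp add: add.assoc)
  qed
  ultimately have "affine_tensor_map n c c' (L' \<circ> L)"
    unfolding affine_tensor_map_def
    by (intro exI[of _ "T' \<circ> T"] bexI[of _ "\<lambda>i j s. T' B i j s + B' i j s"]) blast+
  then show ?thesis
    using assms LX by (simp add: equivariant_layer_def)
qed

text \<open>The rule \<open>comp\<close> always inserts a ReLU, so a layer appended without one is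
  absorbed into the last layer of \<open>F\<close>.\<close>

lemma equivariant_network_layer_comp:
  assumes "equivariant_network n c b F" "equivariant_layer n b c' L"
  shows "equivariant_network n c c' (L \<circ> F)"
  using assms(1)
proof cases
  case single
  then show ?thesis
    using equivariant_layer_comp assms(2) equivariant_network.single by blast
next
  case (comp b' F' L')
  then have "equivariant_network n c c' ((L \<circ> L') \<circ> relu \<circ> F')"
    using equivariant_layer_comp assms(2) equivariant_network.comp by blast
  then show ?thesis
    using comp by (simp add: comp_assoc)
qed

section \<open>Functions computed by networks\<close>

text \<open>The input survives in the first \<open>c\<close> channels, so every later construction,
  including the final layer, can still read it exactly.\<close>

definition retaining_network ::
  "nat \<Rightarrow> nat \<Rightarrow> nat \<Rightarrow> ((nat \<Rightarrow> nat \<Rightarrow> nat \<Rightarrow> real) \<Rightarrow> (nat \<Rightarrow> nat \<Rightarrow> nat \<Rightarrow> real)) \<Rightarrow> bool" where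
  "retaining_network n c b F \<longleftrightarrow> equivariant_network n c b F \<and> c \<le> b \<and>
     (\<forall>X. \<forall>i<n. \<forall>j<n. \<forall>s<c. F X i j s = X i j s)"

text \<open>Old channels keep their numbers, so positions found earlier remain valid after an
  extension.\<close>

definition extends_network ::
  "nat \<Rightarrow> nat \<Rightarrow> ((nat \<Rightarrow> nat \<Rightarrow> nat \<Rightarrow> real) \<Rightarrow> (nat \<Rightarrow> nat \<Rightarrow> nat \<Rightarrow> real)) \<Rightarrow>
   ((nat \<Rightarrow> nat \<Rightarrow> nat \<Rightarrow> real) \<Rightarrow> (nat \<Rightarrow> nat \<Rightarrow> nat \<Rightarrow> real)) \<Rightarrow> bool" where
  "extends_network n b F F' \<longleftrightarrow> (\<forall>X. \<forall>i<n. \<forall>j<n. \<forall>s<b. F' X i j s = F X i j s)"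

lemma retaining_network_extends:
  "retaining_network n c b F \<Longrightarrow> equivariant_network n c b' F' \<Longrightarrow> b \<le> b' \<Longrightarrow>
    extends_network n b F F' \<Longrightarrow> retaining_network n c b' F'"
  by (auto simp: retaining_network_def extends_network_def)

lemma retaining_network_exists: "\<exists>F. retaining_network n c c F"
proof -
  let ?F = "affine_layer n c (\<lambda>s. 0) (\<lambda>s X i j. X i j s)"
  have "equivariant_network n c c ?F"
    by (intro equivariant_network.single equivariant_layer_affine_layer equivariant_linear_entry)
  then have "retaining_network n c c ?F"
    by (simp add: retaining_network_def affine_layer_def)
  then show ?thesis by blast
qed

text \<open>One more layer copies the \<open>b\<close> old channels and writes the new value into
  channel \<open>b\<close>; it merges with the last layer of \<open>F\<close>.\<close>

lemma extend_affine:
  assumes F: "retaining_network n c b F" and G: "equivariant_linear n G"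
  obtains F' where "retaining_network n c (Suc b) F'" "extends_network n b F F'"
    "\<And>X i j. i < n \<Longrightarrow> j < n \<Longrightarrow> F' X i j b = \<beta> + G (F X) i j"
proof -
  let ?L = "affine_layer n (Suc b) (\<lambda>s. if s < b then 0 else \<beta>)
    (\<lambda>s. if s < b then \<lambda>X i j. X i j s else G)"
  have "equivariant_layer n b (Suc b) ?L"
    by (intro equivariant_layer_affine_layer) (simp add: G equivariant_linear_entry)
  then have net: "equivariant_network n c (Suc b) (?L \<circ> F)"
    using F equivariant_network_layer_comp unfolding retaining_network_def by blast
  have ext: "extends_network n b F (?L \<circ> F)"
    by (simp add: extends_network_def affine_layer_def)
  show ?thesis
    using retaining_network_extends[OF F net _ ext] ext
    by (intro that[of "?L \<circ> F"]) (auto simp: affine_layer_def)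
qed

text \<open>The old channels pass through the nonlinearity as \<open>x = max x 0 - max (- x) 0\<close>.\<close>

lemma extend_relu:
  assumes F: "retaining_network n c b F" and k: "k < b"
  obtains F' where "retaining_network n c (Suc b) F'" "extends_network n b F F'"
    "\<And>X i j. i < n \<Longrightarrow> j < n \<Longrightarrow> F' X i j b = max (F X i j k) 0"
proof -
  \<comment> \<open>The channels are doubled: channel \<open>s < b\<close> keeps its value, channel
    \<open>s + b\<close> receives the negated value.\<close>
  let ?D = "affine_layer n (2 * b) (\<lambda>s. 0)
    (\<lambda>s X i j. (if s < b then 1 else -1) * X i j (if s < b then s else s - b))"
  \<comment> \<open>Old channels are recombined as a difference. For the new channel
    \<open>s = b\<close> the second coefficient is 0, so only the ReLU of channel \<open>k\<close>
    remains, and the read at \<open>2 * b\<close>, past the last channel, does no harm.\<close>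
  let ?L = "affine_layer n (Suc b) (\<lambda>s. 0)
    (\<lambda>s X i j. X i j (if s < b then s else k) + (if s < b then -1 else 0) * X i j (s + b))"
  have "equivariant_layer n b (2 * b) ?D"
    by (intro equivariant_layer_affine_layer equivariant_linear_scale equivariant_linear_entry)
  then have "equivariant_network n c (2 * b) (?D \<circ> F)"
    using F equivariant_network_layer_comp unfolding retaining_network_def by blast
  moreover have "equivariant_layer n (2 * b) (Suc b) ?L"
    by (intro equivariant_layer_affine_layer equivariant_linear_add equivariant_linear_scale
        equivariant_linear_entry)
  ultimately have net: "equivariant_network n c (Suc b) (?L \<circ> relu \<circ> (?D \<circ> F))"
    using k by (intro equivariant_network.comp) auto
  have ext: "extends_network n b F (?L \<circ> relu \<circ> (?D \<circ> F))"
    by (simp add: extends_network_def affine_layer_def relu_def max_def)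
  show ?thesis
    using retaining_network_extends[OF F net _ ext] ext k
    by (intro that[of "?L \<circ> relu \<circ> (?D \<circ> F)"]) (auto simp: affine_layer_def relu_def)
qed

text \<open>Quantifying over every retaining \<open>F\<close> lets computations be chained: a second
  function can be added to a network that already holds the first.\<close>

definition computable ::
  "nat \<Rightarrow> nat \<Rightarrow> ((nat \<Rightarrow> nat \<Rightarrow> nat \<Rightarrow> real) \<Rightarrow> nat \<Rightarrow> nat \<Rightarrow> real) \<Rightarrow> bool" where
  "computable n c f \<longleftrightarrow> (\<forall>b F. retaining_network n c b F \<longrightarrow>
     (\<exists>b' F' k. b \<le> b' \<and> retaining_network n c b' F' \<and> extends_network n b F F' \<and> k < b' \<and>
       (\<forall>X. \<forall>i<n. \<forall>j<n. F' X i j k = f X i j)))"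

lemma computableE:
  assumes "computable n c f" "retaining_network n c b F"
  obtains b' F' k where "b \<le> b'" "retaining_network n c b' F'" "extends_network n b F F'" "k < b'"
    "\<And>X i j. i < n \<Longrightarrow> j < n \<Longrightarrow> F' X i j k = f X i j"
  using assms unfolding computable_def by metis

lemma extends_network_trans:
  "extends_network n b F F' \<Longrightarrow> extends_network n b' F' F'' \<Longrightarrow> b \<le> b' \<Longrightarrow> extends_network n b F F''"
  by (auto simp: extends_network_def)

text \<open>A retaining network agrees with its input only inside the index range, so
  \<open>local\<close> is what yields \<open>G (F X) i j = G X i j\<close> there.\<close>

lemma computable_input:
  assumes G: "equivariant_linear n G"
    and local: "\<And>X Y i j. i < n \<Longrightarrow> j < n \<Longrightarrow> (\<And>i j s. i < n \<Longrightarrow> j < n \<Longrightarrow> s < c \<Longrightarrow> X i j s = Y i j s) \<Longrightarrow>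
      G X i j = G Y i j"
  shows "computable n c (\<lambda>X i j. \<beta> + G X i j)"
  unfolding computable_def
proof (intro allI impI)
  fix b F assume F: "retaining_network n c b F"
  obtain F' where F': "retaining_network n c (Suc b) F'" "extends_network n b F F'"
    "\<And>X i j. i < n \<Longrightarrow> j < n \<Longrightarrow> F' X i j b = \<beta> + G (F X) i j"
    using extend_affine[OF F G] by metis
  have "G (F X) i j = G X i j" if "i < n" "j < n" for X i j
    using F that by (intro local) (auto simp: retaining_network_def)
  then show "\<exists>b' F' k. b \<le> b' \<and> retaining_network n c b' F' \<and> extends_network n b F F' \<and> k < b' \<and>
       (\<forall>X. \<forall>i<n. \<forall>j<n. F' X i j k = \<beta> + G X i j)"
    using F' by (intro exI[of _ "Suc b"] exI[of _ F'] exI[of _ b]) auto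
qed

lemma computable_const: "computable n c (\<lambda>X i j. a)"
  using computable_input[OF equivariant_linear_zero, of n c a] by simp

lemma computable_entry: "t < c \<Longrightarrow> computable n c (\<lambda>X i j. X i j t)"
  using computable_input[OF equivariant_linear_entry, of n c t 0] by simp

lemma computable_row_node: "t < c \<Longrightarrow> computable n c (\<lambda>X i j. X i i t)"
  using computable_input[OF equivariant_linear_row_node, of n c t 0] by simp

lemma computable_column_node: "t < c \<Longrightarrow> computable n c (\<lambda>X i j. X j j t)"
  using computable_input[OF equivariant_linear_column_node, of n c t 0] by simp

text \<open>The channel holding \<open>f\<close> is known only once the network has been extended.
  Hence \<open>G\<close> is indexed by the channel number and has to produce \<open>g\<close> from
  any array that holds \<open>f X\<close> in that channel.\<close>

lemma computable_unary:
  assumes f: "computable n c f"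
    and G: "\<And>k. equivariant_linear n (G k)"
    and g: "\<And>X Y i j k. i < n \<Longrightarrow> j < n \<Longrightarrow> (\<And>i j. i < n \<Longrightarrow> j < n \<Longrightarrow> Y i j k = f X i j) \<Longrightarrow>
      G k Y i j = g X i j"
  shows "computable n c g"
  unfolding computable_def
proof (intro allI impI)
  fix b F assume F: "retaining_network n c b F"
  obtain b1 F1 k where 1: "b \<le> b1" "retaining_network n c b1 F1" "extends_network n b F F1" "k < b1"
    "\<And>X i j. i < n \<Longrightarrow> j < n \<Longrightarrow> F1 X i j k = f X i j"
    using computableE[OF f F] by metis
  obtain F2 where 2: "retaining_network n c (Suc b1) F2" "extends_network n b1 F1 F2"
    "\<And>X i j. i < n \<Longrightarrow> j < n \<Longrightarrow> F2 X i j b1 = 0 + G k (F1 X) i j"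
    using extend_affine[OF 1(2) G] by metis
  have "G k (F1 X) i j = g X i j" if "i < n" "j < n" for X i j
    using g[OF that] 1(5) by blast
  then show "\<exists>b' F' k. b \<le> b' \<and> retaining_network n c b' F' \<and> extends_network n b F F' \<and> k < b' \<and>
       (\<forall>X. \<forall>i<n. \<forall>j<n. F' X i j k = g X i j)"
    using 1 2 extends_network_trans[OF 1(3) 2(2) 1(1)]
    by (intro exI[of _ "Suc b1"] exI[of _ F2] exI[of _ b1]) auto
qed

lemma computable_scale:
  assumes "computable n c f"
  shows "computable n c (\<lambda>X i j. a * f X i j)"
proof (rule computable_unary[OF assms, where G = "\<lambda>k X i j. a * X i j k"])
  show "equivariant_linear n (\<lambda>X i j. a * X i j k)" for k
    by (rule equivariant_linear_scale[OF equivariant_linear_entry])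
qed simp

lemma computable_row_sum:
  assumes "computable n c f"
  shows "computable n c (\<lambda>X i j. \<Sum>k<n. f X i k)"
proof (rule computable_unary[OF assms, where G = "\<lambda>t X i j. \<Sum>k<n. X i k t"])
  show "equivariant_linear n (\<lambda>X i j. \<Sum>k<n. X i k t)" for t
    by (rule equivariant_linear_row_sum)
qed simp

text \<open>The function \<open>g\<close> is computed on top of the network for \<open>f\<close>,
  whose result stays in channel \<open>k\<close>; one more layer adds the two channels.\<close>

lemma computable_add:
  assumes f: "computable n c f" and g: "computable n c g"
  shows "computable n c (\<lambda>X i j. f X i j + g X i j)"
  unfolding computable_def
proof (intro allI impI)
  fix b F assume F: "retaining_network n c b F"
  obtain b1 F1 k where 1: "b \<le> b1" "retaining_network n c b1 F1" "extends_network n b F F1" "k < b1"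
    "\<And>X i j. i < n \<Longrightarrow> j < n \<Longrightarrow> F1 X i j k = f X i j"
    using computableE[OF f F] by metis
  obtain b2 F2 k' where 2: "b1 \<le> b2" "retaining_network n c b2 F2" "extends_network n b1 F1 F2"
    "k' < b2" "\<And>X i j. i < n \<Longrightarrow> j < n \<Longrightarrow> F2 X i j k' = g X i j"
    using computableE[OF g 1(2)] by metis
  have k: "F2 X i j k = f X i j" if "i < n" "j < n" for X i j
    using 1(4,5) 2(3) that by (simp add: extends_network_def)
  have sum: "equivariant_linear n (\<lambda>X i j. X i j k + X i j k')"
    by (intro equivariant_linear_add equivariant_linear_entry)
  obtain F3 where 3: "retaining_network n c (Suc b2) F3" "extends_network n b2 F2 F3"
    "\<And>X i j. i < n \<Longrightarrow> j < n \<Longrightarrow> F3 X i j b2 = 0 + (F2 X i j k + F2 X i j k')"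
    by (rule extend_affine[OF 2(2) sum, where \<beta> = 0]) (rule that; assumption)
  have "extends_network n b F F3"
    by (rule extends_network_trans[OF extends_network_trans[OF 1(3) 2(3) 1(1)] 3(2)])
      (use 1(1) 2(1) in simp)
  then show "\<exists>b' F' k. b \<le> b' \<and> retaining_network n c b' F' \<and> extends_network n b F F' \<and> k < b' \<and>
       (\<forall>X. \<forall>i<n. \<forall>j<n. F' X i j k = f X i j + g X i j)"
    using 1(1) 2(1,5) 3(1,3) k
    by (intro exI[of _ "Suc b2"] exI[of _ F3] exI[of _ b2]) auto
qed

lemma computable_relu:
  assumes f: "computable n c f"
  shows "computable n c (\<lambda>X i j. max (f X i j) 0)"
  unfolding computable_def
proof (intro allI impI)
  fix b F assume F: "retaining_network n c b F"
  obtain b1 F1 k where 1: "b \<le> b1" "retaining_network n c b1 F1" "extends_network n b F F1" "k < b1"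
    "\<And>X i j. i < n \<Longrightarrow> j < n \<Longrightarrow> F1 X i j k = f X i j"
    using computableE[OF f F] by metis
  obtain F2 where 2: "retaining_network n c (Suc b1) F2" "extends_network n b1 F1 F2"
    "\<And>X i j. i < n \<Longrightarrow> j < n \<Longrightarrow> F2 X i j b1 = max (F1 X i j k) 0"
    using extend_relu[OF 1(2,4)] by metis
  show "\<exists>b' F' k. b \<le> b' \<and> retaining_network n c b' F' \<and> extends_network n b F F' \<and> k < b' \<and>
       (\<forall>X. \<forall>i<n. \<forall>j<n. F' X i j k = max (f X i j) 0)"
    using 1 2 extends_network_trans[OF 1(3) 2(2) 1(1)]
    by (intro exI[of _ "Suc b1"] exI[of _ F2] exI[of _ b1]) auto
qed

text \<open>Each induction step extends the network built so far, so that one network finally holds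
  all values, with \<open>k t\<close> the position of the \<open>t\<close>-th.\<close>

lemma computable_family:
  fixes m :: nat
  assumes "\<And>t. t < m \<Longrightarrow> computable n c (f t)"
  shows "\<exists>b F k. retaining_network n c b F \<and>
    (\<forall>t<m. k t < b \<and> (\<forall>X. \<forall>i<n. \<forall>j<n. F X i j (k t) = f t X i j))"
  using assms
proof (induction m)
  case 0
  then show ?case using retaining_network_exists by blast
next
  case (Suc m)
  from Suc.IH[OF Suc.prems[OF less_SucI]] obtain b F k where F: "retaining_network n c b F"
    and k: "\<And>t. t < m \<Longrightarrow> k t < b \<and> (\<forall>X. \<forall>i<n. \<forall>j<n. F X i j (k t) = f t X i j)"
    by blast
  obtain b1 F1 k1 where 1: "b \<le> b1" "retaining_network n c b1 F1" "extends_network n b F F1"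
    "k1 < b1" "\<And>X i j. i < n \<Longrightarrow> j < n \<Longrightarrow> F1 X i j k1 = f m X i j"
    using computableE[OF Suc.prems[OF lessI] F] by metis
  have "(k(m := k1)) t < b1 \<and> (\<forall>X. \<forall>i<n. \<forall>j<n. F1 X i j ((k(m := k1)) t) = f t X i j)"
    if "t < Suc m" for t
    using 1 k[of t] that by (cases "t = m") (auto simp: extends_network_def)
  then show ?case using 1(2) by blast
qed

section \<open>Uniform limits\<close>

text \<open>Instances have an arbitrary type and reach the network only through \<open>enc\<close>,
  so \<open>f\<close> can be stated in terms of the graph data. The error is uniform over
  \<open>S\<close> and all pairs of nodes.\<close>

definition approximable ::
  "nat \<Rightarrow> nat \<Rightarrow> ('a \<Rightarrow> nat \<Rightarrow> nat \<Rightarrow> nat \<Rightarrow> real) \<Rightarrow> 'a set \<Rightarrow> ('a \<Rightarrow> nat \<Rightarrow> nat \<Rightarrow> real) \<Rightarrow> bool" where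
  "approximable n c enc S f \<longleftrightarrow> (\<forall>\<epsilon>>0. \<exists>g. computable n c g \<and>
     (\<forall>x\<in>S. \<forall>i<n. \<forall>j<n. \<bar>f x i j - g (enc x) i j\<bar> \<le> \<epsilon>))"

lemma approximableE:
  assumes "approximable n c enc S f" "\<epsilon> > 0"
  obtains g where "computable n c g"
    "\<And>x i j. x \<in> S \<Longrightarrow> i < n \<Longrightarrow> j < n \<Longrightarrow> \<bar>f x i j - g (enc x) i j\<bar> \<le> \<epsilon>"
  using assms unfolding approximable_def by metis

lemma approximable_computable:
  assumes "computable n c g" "\<And>x i j. x \<in> S \<Longrightarrow> i < n \<Longrightarrow> j < n \<Longrightarrow> f x i j = g (enc x) i j"
  shows "approximable n c enc S f"
  unfolding approximable_def using assms by (auto intro!: exI[of _ g])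

lemma approximable_const: "approximable n c enc S (\<lambda>x i j. a)"
  by (rule approximable_computable[OF computable_const[of n c a]]) simp

section \<open>Closure properties of the uniform limits\<close>

lemma approximable_add:
  assumes f: "approximable n c enc S f" and g: "approximable n c enc S g"
  shows "approximable n c enc S (\<lambda>x i j. f x i j + g x i j)"
  unfolding approximable_def
proof (intro allI impI)
  fix \<epsilon> :: real assume "\<epsilon> > 0"
  then have e: "\<epsilon> / 2 > 0" by simp
  obtain f' where 1: "computable n c f'"
    "\<And>x i j. x \<in> S \<Longrightarrow> i < n \<Longrightarrow> j < n \<Longrightarrow> \<bar>f x i j - f' (enc x) i j\<bar> \<le> \<epsilon> / 2"
    using approximableE[OF f e] by metis
  obtain g' where 2: "computable n c g'"
    "\<And>x i j. x \<in> S \<Longrightarrow> i < n \<Longrightarrow> j < n \<Longrightarrow> \<bar>g x i j - g' (enc x) i j\<bar> \<le> \<epsilon> / 2"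
    using approximableE[OF g e] by metis
  have "\<bar>f x i j + g x i j - (f' (enc x) i j + g' (enc x) i j)\<bar> \<le> \<epsilon>"
    if "x \<in> S" "i < n" "j < n" for x i j
    using 1(2)[OF that] 2(2)[OF that] by linarith
  then show "\<exists>h. computable n c h \<and>
     (\<forall>x\<in>S. \<forall>i<n. \<forall>j<n. \<bar>f x i j + g x i j - h (enc x) i j\<bar> \<le> \<epsilon>)"
    by (intro exI[of _ "\<lambda>X i j. f' X i j + g' X i j"] conjI computable_add[OF 1(1) 2(1)]) blast
qed

lemma approximable_scale:
  assumes f: "approximable n c enc S f"
  shows "approximable n c enc S (\<lambda>x i j. a * f x i j)"
  unfolding approximable_def
proof (intro allI impI)
  fix \<epsilon> :: real assume \<epsilon>: "\<epsilon> > 0"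
  \<comment> \<open>The added 1 keeps the tolerance positive when \<open>a = 0\<close>.\<close>
  then have e: "\<epsilon> / (\<bar>a\<bar> + 1) > 0" by simp
  obtain f' where 1: "computable n c f'"
    "\<And>x i j. x \<in> S \<Longrightarrow> i < n \<Longrightarrow> j < n \<Longrightarrow> \<bar>f x i j - f' (enc x) i j\<bar> \<le> \<epsilon> / (\<bar>a\<bar> + 1)"
    using approximableE[OF f e] by metis
  have "\<bar>a * f x i j - a * f' (enc x) i j\<bar> \<le> \<epsilon>" if "x \<in> S" "i < n" "j < n" for x i j
  proof -
    have "\<bar>a * f x i j - a * f' (enc x) i j\<bar> = \<bar>a\<bar> * \<bar>f x i j - f' (enc x) i j\<bar>"
      by (simp add: abs_mult flip: right_diff_distrib)
    also have "\<dots> \<le> (\<bar>a\<bar> + 1) * (\<epsilon> / (\<bar>a\<bar> + 1))"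
      using 1(2)[OF that] by (intro mult_mono) auto
    also have "\<dots> = \<epsilon>" by simp
    finally show ?thesis .
  qed
  then show "\<exists>h. computable n c h \<and>
     (\<forall>x\<in>S. \<forall>i<n. \<forall>j<n. \<bar>a * f x i j - h (enc x) i j\<bar> \<le> \<epsilon>)"
    by (intro exI[of _ "\<lambda>X i j. a * f' X i j"] conjI computable_scale[OF 1(1)]) blast
qed

text \<open>ReLU is 1-Lipschitz, so the tolerance carries over unchanged.\<close>

lemma approximable_relu:
  assumes f: "approximable n c enc S f"
  shows "approximable n c enc S (\<lambda>x i j. max (f x i j) 0)"
  unfolding approximable_def
proof (intro allI impI)
  fix \<epsilon> :: real assume \<epsilon>: "\<epsilon> > 0"
  obtain f' where 1: "computable n c f'"
    "\<And>x i j. x \<in> S \<Longrightarrow> i < n \<Longrightarrow> j < n \<Longrightarrow> \<bar>f x i j - f' (enc x) i j\<bar> \<le> \<epsilon>"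
    using approximableE[OF f \<epsilon>] by metis
  have "\<bar>max (f x i j) 0 - max (f' (enc x) i j) 0\<bar> \<le> \<epsilon>" if "x \<in> S" "i < n" "j < n" for x i j
    using 1(2)[OF that] by linarith
  then show "\<exists>h. computable n c h \<and>
     (\<forall>x\<in>S. \<forall>i<n. \<forall>j<n. \<bar>max (f x i j) 0 - h (enc x) i j\<bar> \<le> \<epsilon>)"
    by (intro exI[of _ "\<lambda>X i j. max (f' X i j) 0"] conjI computable_relu[OF 1(1)]) blast
qed

lemma approximable_row_sum:
  assumes f: "approximable n c enc S f"
  shows "approximable n c enc S (\<lambda>x i j. \<Sum>k<n. f x i k)"
  unfolding approximable_def
proof (intro allI impI)
  fix \<epsilon> :: real assume \<epsilon>: "\<epsilon> > 0"
  \<comment> \<open>With \<open>Suc n\<close> for \<open>n\<close> the tolerance is positive even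
    when \<open>n = 0\<close>.\<close>
  then have e: "\<epsilon> / real (Suc n) > 0" by simp
  obtain f' where 1: "computable n c f'"
    "\<And>x i j. x \<in> S \<Longrightarrow> i < n \<Longrightarrow> j < n \<Longrightarrow> \<bar>f x i j - f' (enc x) i j\<bar> \<le> \<epsilon> / real (Suc n)"
    using approximableE[OF f e] by metis
  have "\<bar>(\<Sum>k<n. f x i k) - (\<Sum>k<n. f' (enc x) i k)\<bar> \<le> \<epsilon>" if "x \<in> S" "i < n" for x i
  proof -
    have "\<bar>(\<Sum>k<n. f x i k) - (\<Sum>k<n. f' (enc x) i k)\<bar> \<le> (\<Sum>k<n. \<bar>f x i k - f' (enc x) i k\<bar>)"
      by (simp add: sum_abs flip: sum_subtractf)
    also have "\<dots> \<le> (\<Sum>k<n. \<epsilon> / real (Suc n))"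
      using 1(2) that by (intro sum_mono) auto
    also have "\<dots> \<le> \<epsilon>"
      using \<epsilon> by (simp add: field_simps)
    finally show ?thesis .
  qed
  then show "\<exists>h. computable n c h \<and>
     (\<forall>x\<in>S. \<forall>i<n. \<forall>j<n. \<bar>(\<Sum>k<n. f x i k) - h (enc x) i j\<bar> \<le> \<epsilon>)"
    by (intro exI[of _ "\<lambda>X i j. \<Sum>k<n. f' X i k"] conjI computable_row_sum[OF 1(1)]) blast
qed

text \<open>Half of the tolerance goes to each of two approximations, so it suffices to approach
  \<open>f\<close> by approximable functions instead of computable ones.\<close>

lemma approximable_limit:
  assumes "\<And>\<epsilon>. \<epsilon> > 0 \<Longrightarrow> \<exists>g. approximable n c enc S g \<and>
    (\<forall>x\<in>S. \<forall>i<n. \<forall>j<n. \<bar>f x i j - g x i j\<bar> \<le> \<epsilon>)"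
  shows "approximable n c enc S f"
  unfolding approximable_def
proof (intro allI impI)
  fix \<epsilon> :: real assume "\<epsilon> > 0"
  then have e: "\<epsilon> / 2 > 0" by simp
  obtain g where g: "approximable n c enc S g"
    "\<And>x i j. x \<in> S \<Longrightarrow> i < n \<Longrightarrow> j < n \<Longrightarrow> \<bar>f x i j - g x i j\<bar> \<le> \<epsilon> / 2"
    using assms[OF e] by metis
  obtain h where h: "computable n c h"
    "\<And>x i j. x \<in> S \<Longrightarrow> i < n \<Longrightarrow> j < n \<Longrightarrow> \<bar>g x i j - h (enc x) i j\<bar> \<le> \<epsilon> / 2"
    using approximableE[OF g(1) e] by metis
  have "\<bar>f x i j - h (enc x) i j\<bar> \<le> \<epsilon>" if "x \<in> S" "i < n" "j < n" for x i j
    using g(2)[OF that] h(2)[OF that] by linarith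
  then show "\<exists>h. computable n c h \<and> (\<forall>x\<in>S. \<forall>i<n. \<forall>j<n. \<bar>f x i j - h (enc x) i j\<bar> \<le> \<epsilon>)"
    using h(1) by blast
qed

lemma approximable_max:
  assumes "approximable n c enc S f" "approximable n c enc S g"
  shows "approximable n c enc S (\<lambda>x i j. max (f x i j) (g x i j))"
proof -
  \<comment> \<open>The difference is written with \<open>(-1) *\<close> so that the closure rules
    match it.\<close>
  have "approximable n c enc S (\<lambda>x i j. max (f x i j + (-1) * g x i j) 0 + g x i j)"
    by (intro approximable_add approximable_relu approximable_scale assms)
  moreover have "max (f x i j + (-1) * g x i j) 0 + g x i j = max (f x i j) (g x i j)" for x i j
    by linarith
  ultimately show ?thesis by (simp only:)
qed

lemma approximable_abs:
  assumes "approximable n c enc S f"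
  shows "approximable n c enc S (\<lambda>x i j. \<bar>f x i j\<bar>)"
proof -
  have "approximable n c enc S (\<lambda>x i j. max (f x i j) ((-1) * f x i j))"
    by (intro approximable_max approximable_scale assms)
  moreover have "max (f x i j) ((-1) * f x i j) = \<bar>f x i j\<bar>" for x i j
    by linarith
  ultimately show ?thesis by (simp only:)
qed

lemma approximable_sum:
  assumes "finite P" "\<And>p. p \<in> P \<Longrightarrow> approximable n c enc S (f p)"
  shows "approximable n c enc S (\<lambda>x i j. \<Sum>p\<in>P. f p x i j)"
  using assms
proof (induction P rule: finite_induct)
  case empty
  show ?case by (simp add: approximable_const)
next
  case (insert p P)
  have "approximable n c enc S (\<lambda>x i j. f p x i j + (\<Sum>p\<in>P. f p x i j))"
    using insert.prems by (intro approximable_add insert.IH) blast+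
  then show ?case by (simp only: sum.insert[OF insert.hyps])
qed

lemma approximable_Max:
  assumes "finite P" "P \<noteq> {}" "\<And>p. p \<in> P \<Longrightarrow> approximable n c enc S (f p)"
  shows "approximable n c enc S (\<lambda>x i j. MAX p\<in>P. f p x i j)"
  using assms
proof (induction P rule: finite_ne_induct)
  case (singleton p)
  then show ?case by simp
next
  case (insert p P)
  have "approximable n c enc S (\<lambda>x i j. max (f p x i j) (MAX p\<in>P. f p x i j))"
    using insert.prems by (intro approximable_max insert.IH) blast+
  moreover have "(MAX q\<in>insert p P. f q x i j) = max (f p x i j) (MAX q\<in>P. f q x i j)" for x i j
    using insert.hyps by simp
  ultimately show ?case by (simp only:)
qed

section \<open>Approximation of continuous functions\<close>

text \<open>The approximant is the upper envelope of finitely many downward cones of slope \<open>L\<close>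
  with apices on the graph of \<open>f\<close>; only the separation axiom of a metric is needed.\<close>

lemma max_cone_approximation:
  fixes f :: "'a::topological_space \<Rightarrow> real" and \<rho> :: "'a \<Rightarrow> 'a \<Rightarrow> real"
  assumes B: "compact B" "B \<noteq> {}" and f: "continuous_on B f"
    and \<rho>: "continuous_on (B \<times> B) (\<lambda>(x, y). \<rho> x y)"
    and nonneg: "\<And>x y. \<rho> x y \<ge> 0" and refl: "\<And>x. \<rho> x x = 0"
    and sep: "\<And>x y. x \<in> B \<Longrightarrow> y \<in> B \<Longrightarrow> \<rho> x y = 0 \<Longrightarrow> x = y"
    and \<epsilon>: "\<epsilon> > 0"
  obtains N L where "finite N" "N \<noteq> {}" "N \<subseteq> B"
    "\<And>x. x \<in> B \<Longrightarrow> \<bar>f x - (MAX y\<in>N. f y - L * \<rho> x y)\<bar> \<le> \<epsilon>"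
proof -
  \<comment> \<open>One half pays for the oscillation of \<open>f\<close> near an apex, the other
    for the drop of the cone.\<close>
  define e where "e = \<epsilon> / 2"
  have e: "e > 0" using \<epsilon> by (simp add: e_def)
  have "bounded (f ` B)"
    by (intro compact_imp_bounded compact_continuous_image f B)
  then obtain b where b: "\<And>x. x \<in> B \<Longrightarrow> \<bar>f x\<bar> \<le> b" and b0: "b > 0"
    unfolding bounded_pos by auto
  \<comment> \<open>The pairs on which \<open>f\<close> differs by at least \<open>e\<close>. This
    set is compact and misses the diagonal, so \<open>\<rho>\<close> has a positive lower bound
    \<open>\<delta>\<close> on it; this stands in for uniform continuity.\<close>
  define D where "D = (B \<times> B) \<inter> (\<lambda>(x, y). \<bar>f x - f y\<bar>) -` {e..}"
  have cont: "continuous_on (B \<times> B) (\<lambda>(x, y). \<bar>f x - f y\<bar>)"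
    unfolding case_prod_beta
    by (intro continuous_intros continuous_on_compose2[OF f]) auto
  obtain T where T: "closed T" "T \<inter> (B \<times> B) = D"
    using cont[unfolded continuous_on_closed_invariant, rule_format, OF closed_atLeast[of e]]
    unfolding D_def by (auto simp: Int_commute)
  then have D: "compact D"
    using compact_Int_closed[OF compact_Times[OF B(1) B(1)] T(1)] by (simp add: Int_commute)
  obtain \<delta> where \<delta>: "\<delta> > 0" and \<delta>D: "\<And>x y. (x, y) \<in> D \<Longrightarrow> \<rho> x y \<ge> \<delta>"
  proof (cases "D = {}")
    case True
    then show ?thesis using that[of 1] by simp
  next
    case False
    have "continuous_on D (\<lambda>(x, y). \<rho> x y)"
      using continuous_on_subset[OF \<rho>] by (simp add: D_def)
    then obtain z where z: "z \<in> D" "\<And>w. w \<in> D \<Longrightarrow> case_prod \<rho> z \<le> case_prod \<rho> w"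
      using continuous_attains_inf[OF D False, of "case_prod \<rho>"] by blast
    obtain x y where xy: "z = (x, y)" by fastforce
    have "\<rho> x y \<noteq> 0"
      using z(1) sep[of x y] e by (auto simp: D_def xy)
    then have "\<rho> x y > 0" using nonneg[of x y] by simp
    then show ?thesis using that[of "\<rho> x y"] z(2) by (auto simp: xy)
  qed
  have close: "\<bar>f x - f y\<bar> < e" if "x \<in> B" "y \<in> B" "\<rho> x y < \<delta>" for x y
    using \<delta>D[of x y] that by (force simp: D_def)
  \<comment> \<open>With this slope a cone has dropped by \<open>2 * b\<close> at distance
    \<open>\<delta>\<close>, so cones with distant apices stay below \<open>f x\<close>.\<close>
  define L where "L = 2 * b / \<delta>"
  have L: "L > 0" using b0 \<delta> by (simp add: L_def)
  \<comment> \<open>The bound \<open>\<delta>\<close> controls the oscillation of \<open>f\<close>,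
    the bound \<open>e / L\<close> the drop of the cone.\<close>
  define \<eta> where "\<eta> = min \<delta> (e / L)"
  have \<eta>: "\<eta> > 0" using \<delta> e L by (simp add: \<eta>_def)
  \<comment> \<open>The \<open>\<rho>\<close>-balls of radius \<open>\<eta>\<close> are relatively
    open, so compactness gives a finite net \<open>N\<close> of apices.\<close>
  have "\<exists>W. open W \<and> W \<inter> B = (\<lambda>x. \<rho> x y) -` {..<\<eta>} \<inter> B" if "y \<in> B" for y
  proof -
    have "continuous_on B (\<lambda>x. (\<lambda>(x, y). \<rho> x y) (x, y))"
      by (rule continuous_on_compose2[OF \<rho>]) (use that in \<open>auto intro!: continuous_intros\<close>)
    then have "continuous_on B (\<lambda>x. \<rho> x y)" by simp
    then show ?thesis
      unfolding continuous_on_open_invariant using open_lessThan[of \<eta>] by blast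
  qed
  then have "\<exists>W. \<forall>y\<in>B. open (W y) \<and> W y \<inter> B = (\<lambda>x. \<rho> x y) -` {..<\<eta>} \<inter> B"
    by (intro bchoice ballI)
  then obtain W where W: "\<And>y. y \<in> B \<Longrightarrow> open (W y)"
    "\<And>y. y \<in> B \<Longrightarrow> W y \<inter> B = (\<lambda>x. \<rho> x y) -` {..<\<eta>} \<inter> B"
    by blast
  have "B \<subseteq> (\<Union>y\<in>B. W y)"
    using W(2) refl \<eta> by fastforce
  then obtain N where N: "N \<subseteq> B" "finite N" "B \<subseteq> (\<Union>y\<in>N. W y)"
    using compactE_image[OF B(1), of B W] W(1) by blast
  have net: "\<exists>y\<in>N. \<rho> x y < \<eta>" if "x \<in> B" for x
    using N W(2) that by blast
  have N0: "N \<noteq> {}" using N(3) B(2) by auto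
  have "\<bar>f x - (MAX y\<in>N. f y - L * \<rho> x y)\<bar> \<le> \<epsilon>" if x: "x \<in> B" for x
  proof -
    \<comment> \<open>Upper bound: a near apex is controlled by \<open>close\<close>, a distant one
      by the slope.\<close>
    have "f y - L * \<rho> x y \<le> f x + e" if y: "y \<in> N" for y
    proof (cases "\<rho> x y < \<delta>")
      case True
      then have "f y \<le> f x + e" using close[of x y] x y N(1) by auto
      moreover have "L * \<rho> x y \<ge> 0" using L nonneg by simp
      ultimately show ?thesis by linarith
    next
      case False
      then have "L * \<delta> \<le> L * \<rho> x y" using L by simp
      moreover have "L * \<delta> = 2 * b" using \<delta> by (simp add: L_def)
      moreover have "\<bar>f y\<bar> \<le> b" "\<bar>f x\<bar> \<le> b" using b x y N(1) by auto
      ultimately show ?thesis using e by linarith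
    qed
    then have "(MAX y\<in>N. f y - L * \<rho> x y) \<le> f x + e"
      using N(2) N0 by simp
    \<comment> \<open>Lower bound: a single cone whose apex is within \<open>\<eta>\<close> of
      \<open>x\<close> suffices.\<close>
    moreover obtain y where y: "y \<in> N" "\<rho> x y < \<eta>" using net[OF x] by blast
    have "f y - L * \<rho> x y \<le> (MAX y\<in>N. f y - L * \<rho> x y)"
      using N(2) y(1) by simp
    moreover have "f x - e \<le> f y"
      using close[of x y] x y N(1) by (auto simp: \<eta>_def)
    moreover have "L * \<rho> x y \<le> e"
      using y(2) L by (simp add: \<eta>_def field_simps)
    ultimately show ?thesis using e unfolding e_def by linarith
  qed
  then show ?thesis using that N(1,2) N0 by blast
qed

text \<open>The finitely many maps in \<open>P\<close> act as coordinates: they separate the points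
  of \<open>B\<close>, so the sum of their absolute differences serves as \<open>\<rho>\<close> in
  \<open>max_cone_approximation\<close>. Each cone is then built from the approximable
  \<open>\<pi> (\<phi> x i j)\<close> by absolute values, sums and scaling.\<close>

lemma approximable_continuous:
  fixes f :: "'b::topological_space \<Rightarrow> real"
  assumes B: "compact B" and f: "continuous_on B f"
    and P: "finite P" "\<And>\<pi>. \<pi> \<in> P \<Longrightarrow> continuous_on B \<pi>"
    and sep: "\<And>x y. x \<in> B \<Longrightarrow> y \<in> B \<Longrightarrow> (\<And>\<pi>. \<pi> \<in> P \<Longrightarrow> \<pi> x = \<pi> y) \<Longrightarrow> x = y"
    and \<phi>: "\<And>x i j. x \<in> S \<Longrightarrow> i < n \<Longrightarrow> j < n \<Longrightarrow> \<phi> x i j \<in> B"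
    and approx: "\<And>\<pi>. \<pi> \<in> P \<Longrightarrow> approximable n c enc S (\<lambda>x i j. \<pi> (\<phi> x i j))"
  shows "approximable n c enc S (\<lambda>x i j. f (\<phi> x i j))"
proof (cases "B = {}")
  \<comment> \<open>No instance with a pair of nodes exists in this case, and any constant will
    do.\<close>
  case True
  then show ?thesis
    using \<phi> by (intro approximable_computable[OF computable_const]) auto
next
  case False
  define \<rho> where "\<rho> = (\<lambda>x y. \<Sum>\<pi>\<in>P. \<bar>\<pi> x - \<pi> y\<bar>)"
  have \<rho>: "continuous_on (B \<times> B) (\<lambda>(x, y). \<rho> x y)"
    unfolding \<rho>_def case_prod_beta
    by (intro continuous_intros continuous_on_compose2[OF P(2)]) auto
  have \<rho>0: "x = y" if "x \<in> B" "y \<in> B" "\<rho> x y = 0" for x y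
    using that(3) P(1) by (intro sep that(1,2)) (simp add: \<rho>_def sum_nonneg_eq_0_iff)
  have \<rho>_nonneg: "\<rho> x y \<ge> 0" and \<rho>_refl: "\<rho> x x = 0" for x y
    by (simp_all add: \<rho>_def sum_nonneg)
  show ?thesis
  proof (rule approximable_limit)
    fix \<epsilon> :: real assume \<epsilon>: "\<epsilon> > 0"
    obtain N L where N: "finite N" "N \<noteq> {}"
      and app: "\<And>x. x \<in> B \<Longrightarrow> \<bar>f x - (MAX y\<in>N. f y - L * \<rho> x y)\<bar> \<le> \<epsilon>"
      by (rule max_cone_approximation[OF B False f \<rho> \<rho>_nonneg \<rho>_refl \<rho>0 \<epsilon>]) (assumption | rule that)+
    have "approximable n c enc S
        (\<lambda>x i j. MAX y\<in>N. f y + (- L) * (\<Sum>\<pi>\<in>P. \<bar>\<pi> (\<phi> x i j) + - \<pi> y\<bar>))"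
      by (intro approximable_Max N approximable_add approximable_const approximable_scale
          approximable_sum P(1) approximable_abs approx)
    then have "approximable n c enc S (\<lambda>x i j. MAX y\<in>N. f y - L * \<rho> (\<phi> x i j) y)"
      by (simp add: \<rho>_def)
    then show "\<exists>g. approximable n c enc S g \<and>
        (\<forall>x\<in>S. \<forall>i<n. \<forall>j<n. \<bar>f (\<phi> x i j) - g x i j\<bar> \<le> \<epsilon>)"
      using app \<phi> by blast
  qed
qed

lemma approximable_cong:
  assumes "approximable n c enc S f" "\<And>x i j. x \<in> S \<Longrightarrow> i < n \<Longrightarrow> j < n \<Longrightarrow> g x i j = f x i j"
  shows "approximable n c enc S g"
  using assms(1) by (intro approximable_limit exI[of _ f]) (simp add: assms(2))

section \<open>Message passing\<close>

text \<open>The first \<open>d\<close> coordinates separate the points of \<open>vecs d\<close>, as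
  needed for \<open>approximable_continuous\<close>.\<close>

lemma vecs_eqI:
  assumes "x \<in> vecs d" "y \<in> vecs d" "\<And>t. t < d \<Longrightarrow> x t = y t"
  shows "x = y"
proof
  fix t
  show "x t = y t"
    using assms by (cases "t < d") (simp_all add: vecs_def)
qed

text \<open>The instances are the triples \<open>(A, H, E)\<close>. A compact set carrying the arguments of \<open>U\<close>
  arises as a finite union over the possible neighbourhoods \<open>W\<close>.\<close>

lemma mp_layer_approximable:
  fixes M :: "(nat \<Rightarrow> real) \<times> (nat \<Rightarrow> real) \<times> (nat \<Rightarrow> real) \<Rightarrow> (nat \<Rightarrow> real)"
    and U :: "(nat \<Rightarrow> real) \<times> (nat \<Rightarrow> real) \<Rightarrow> (nat \<Rightarrow> real)"
  assumes M: "M \<in> vecs d \<times> vecs d \<times> vecs l \<rightarrow> vecs d'"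
    and contM: "continuous_on (vecs d \<times> vecs d \<times> vecs l) M"
    and contU: "continuous_on (vecs d \<times> vecs d') U"
    and K: "K \<subseteq> mats n d \<times> tensors n l" "compact K"
  shows "approximable n (1 + l + d) (\<lambda>(A, H, E). encoding n l d A E H)
    ({A. \<forall>u<n. \<forall>v<n. A u v \<in> {0, 1}} \<times> K)
    (\<lambda>x i j. mp_layer n M U (fst x) (snd (snd x)) (fst (snd x)) i k)"
proof -
  define enc where
    "enc = (\<lambda>(A :: nat \<Rightarrow> nat \<Rightarrow> real, H, E). encoding n l d A E H)"
  define S where "S = {A :: nat \<Rightarrow> nat \<Rightarrow> real. \<forall>u<n. \<forall>v<n. A u v \<in> {0, 1}} \<times> K"
  have S_adj: "fst x i j \<in> {0, 1}" and S_K: "snd x \<in> K" if "x \<in> S" "i < n" "j < n" for x i j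
    using that unfolding S_def mem_Times_iff mem_Collect_eq by blast+
  have H: "fst z u \<in> vecs d" and E: "snd z u v \<in> vecs l" if "z \<in> K" for z u v
    using that K(1) by (auto simp: vecs_def mats_def tensors_def)
  have contH: "continuous_on K (\<lambda>z. fst z u)" for u
    by (rule continuous_on_product_then_coordinatewise[OF continuous_on_fst[OF continuous_on_id]])
  have contE: "continuous_on K (\<lambda>z. snd z u v)" for u v
    by (rule continuous_on_product_then_coordinatewise[OF
          continuous_on_product_then_coordinatewise[OF continuous_on_snd[OF continuous_on_id]]])
  \<comment> \<open>Channel 0 is the adjacency, channel \<open>1 + t\<close> an edge feature. Node
    features sit on the diagonal from channel \<open>1 + l\<close> on, where both nodes of a pair
    can be looked up.\<close>
  have A: "approximable n (1 + l + d) enc S (\<lambda>x i j. fst x i j)"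
    by (rule approximable_computable[OF computable_entry[of 0]])
      (auto simp: enc_def encoding_def)
  have E_approx: "approximable n (1 + l + d) enc S (\<lambda>x i j. snd (snd x) i j t)" if "t < l" for t
    by (rule approximable_computable[OF computable_entry[of "1 + t"]])
      (use that in \<open>auto simp: enc_def encoding_def\<close>)
  have H_row: "approximable n (1 + l + d) enc S (\<lambda>x i j. fst (snd x) i t)" if "t < d" for t
    by (rule approximable_computable[OF computable_row_node[of "1 + l + t"]])
      (use that in \<open>auto simp: enc_def encoding_def\<close>)
  have H_column: "approximable n (1 + l + d) enc S (\<lambda>x i j. fst (snd x) j t)" if "t < d" for t
    by (rule approximable_computable[OF computable_column_node[of "1 + l + t"]])
      (use that in \<open>auto simp: enc_def encoding_def\<close>)

  define a where "a = (\<lambda>u v (z :: (nat \<Rightarrow> nat \<Rightarrow> real) \<times> (nat \<Rightarrow> nat \<Rightarrow> nat \<Rightarrow> real)).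
    (fst z u, fst z v, snd z u v))"
  have a: "continuous_on K (a u v)" for u v
    unfolding a_def by (intro continuous_on_Pair contH contE)
  have a_vecs: "a u v z \<in> vecs d \<times> vecs d \<times> vecs l" if "z \<in> K" for u v z
    using H[OF that] E[OF that] by (simp add: a_def)
  have Ma: "continuous_on K (\<lambda>z. M (a u v z) t)" for u v t
    by (rule continuous_on_product_then_coordinatewise[OF continuous_on_compose2[OF contM a]])
      (use a_vecs in blast)

  \<comment> \<open>The adjacency entry together with the arguments of all messages: a compact set,
    since finitely many continuous images of \<open>K\<close> are united. \<open>P\<close> consists
    of its coordinates.\<close>
  define B where "B = {0, 1 :: real} \<times> (\<Union>(u, v)\<in>{..<n} \<times> {..<n}. a u v ` K)"
  define P :: "(real \<times> (nat \<Rightarrow> real) \<times> (nat \<Rightarrow> real) \<times> (nat \<Rightarrow> real) \<Rightarrow> real) set" where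
    "P = {fst} \<union> (\<lambda>t z. fst (snd z) t) ` {..<d} \<union> (\<lambda>t z. fst (snd (snd z)) t) ` {..<d}
      \<union> (\<lambda>t z. snd (snd (snd z)) t) ` {..<l}"
  have "compact (\<Union>(u, v)\<in>{..<n} \<times> {..<n}. a u v ` K)"
    by (rule compact_UN) (auto intro: compact_continuous_image a K(2))
  moreover have "compact {0, 1 :: real}"
    by (rule finite_imp_compact) simp
  ultimately have B: "compact B"
    unfolding B_def by (intro compact_Times)
  have B_vecs: "B \<subseteq> UNIV \<times> vecs d \<times> vecs d \<times> vecs l"
    using a_vecs unfolding B_def by blast
  \<comment> \<open>A product is neither linear nor a ReLU, so the multiplication by the adjacency
    entry is made part of the continuous function.\<close>
  have M_approx: "approximable n (1 + l + d) enc S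
      (\<lambda>x i j. fst (fst x i j, a i j (snd x)) * M (snd (fst x i j, a i j (snd x))) t)" for t
  proof (rule approximable_continuous[where B = B and P = P])
    show "compact B" by (rule B)
    have "continuous_on B (\<lambda>z. M (snd z))"
      by (rule continuous_on_compose2[OF contM continuous_on_snd[OF continuous_on_id]])
        (use B_vecs in auto)
    then show "continuous_on B (\<lambda>z. fst z * M (snd z) t)"
      by (intro continuous_on_mult continuous_on_fst continuous_on_id
          continuous_on_product_then_coordinatewise[of B "\<lambda>z. M (snd z)"])
    show "finite P" by (simp add: P_def)
    show "continuous_on B \<pi>" if "\<pi> \<in> P" for \<pi>
    proof -
      have "continuous_on B (\<lambda>z. fst (snd z) t)" "continuous_on B (\<lambda>z. fst (snd (snd z)) t)"
        "continuous_on B (\<lambda>z. snd (snd (snd z)) t)" for t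
        by (rule continuous_on_product_then_coordinatewise,
            intro continuous_on_fst continuous_on_snd continuous_on_id)+
      moreover have "continuous_on B fst"
        by (rule continuous_on_fst[OF continuous_on_id])
      ultimately show ?thesis
        using that unfolding P_def by blast
    qed
    show "x = y" if x: "x \<in> B" and y: "y \<in> B" and eq: "\<And>\<pi>. \<pi> \<in> P \<Longrightarrow> \<pi> x = \<pi> y" for x y
    proof -
      have "fst x = fst y" by (rule eq) (simp add: P_def)
      moreover have "fst (snd x) = fst (snd y)"
      proof (rule vecs_eqI[of _ d])
        show "fst (snd x) t = fst (snd y) t" if "t < d" for t
          by (rule eq[of "\<lambda>z. fst (snd z) t"]) (use that in \<open>simp add: P_def\<close>)
      qed (use x y B_vecs in auto)
      moreover have "fst (snd (snd x)) = fst (snd (snd y))"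
      proof (rule vecs_eqI[of _ d])
        show "fst (snd (snd x)) t = fst (snd (snd y)) t" if "t < d" for t
          by (rule eq[of "\<lambda>z. fst (snd (snd z)) t"]) (use that in \<open>simp add: P_def\<close>)
      qed (use x y B_vecs in auto)
      moreover have "snd (snd (snd x)) = snd (snd (snd y))"
      proof (rule vecs_eqI[of _ l])
        show "snd (snd (snd x)) t = snd (snd (snd y)) t" if "t < l" for t
          by (rule eq[of "\<lambda>z. snd (snd (snd z)) t"]) (use that in \<open>simp add: P_def\<close>)
      qed (use x y B_vecs in auto)
      ultimately show ?thesis by (simp add: prod_eq_iff)
    qed
    show "(fst x i j, a i j (snd x)) \<in> B" if "x \<in> S" "i < n" "j < n" for x i j
      using S_adj[OF that] S_K[OF that] that(2,3) unfolding B_def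
      by (intro SigmaI UN_I[of "(i, j)"]) simp_all
    show "approximable n (1 + l + d) enc S (\<lambda>x i j. \<pi> (fst x i j, a i j (snd x)))"
      if "\<pi> \<in> P" for \<pi>
      using that A H_row H_column E_approx unfolding P_def a_def by auto
  qed
  \<comment> \<open>The 0/1 weights turn the sum over neighbours into one over all nodes, that is, a
    row sum.\<close>
  have message_eq: "message n M (fst x) (snd (snd x)) (fst (snd x)) i t =
      (\<Sum>v<n. fst (fst x i v, a i v (snd x)) * M (snd (fst x i v, a i v (snd x))) t)"
    if "x \<in> S" "i < n" for x i t
  proof -
    have "(\<Sum>v<n. fst x i v * M (a i v (snd x)) t) =
        (\<Sum>v\<in>nbrs n (fst x) i. fst x i v * M (a i v (snd x)) t)"
      using S_adj[OF that] by (intro sum.mono_neutral_right) (auto simp: nbrs_def)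
    also have "\<dots> = (\<Sum>v\<in>nbrs n (fst x) i. M (a i v (snd x)) t)"
      by (intro sum.cong) (auto simp: nbrs_def)
    finally show ?thesis by (simp add: message_def a_def)
  qed
  have message_approx: "approximable n (1 + l + d) enc S
      (\<lambda>x i j. message n M (fst x) (snd (snd x)) (fst (snd x)) i t)" for t
    by (rule approximable_cong[OF approximable_row_sum[OF M_approx]]) (rule message_eq)

  \<comment> \<open>For fixed \<open>W\<close> the argument of \<open>U\<close> no longer depends on
    the adjacency and is continuous on \<open>K\<close>.\<close>
  define b where "b = (\<lambda>u W z. (fst z u, \<lambda>t. \<Sum>v\<in>W. M (a u v z) t))"
  define C where "C = (\<Union>(u, W)\<in>{..<n} \<times> Pow {..<n}. b u W ` K)"
  define Q :: "((nat \<Rightarrow> real) \<times> (nat \<Rightarrow> real) \<Rightarrow> real) set" where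
    "Q = (\<lambda>t z. fst z t) ` {..<d} \<union> (\<lambda>t z. snd z t) ` {..<d'}"
  have b: "continuous_on K (b u W)" for u W
    unfolding b_def
    by (rule continuous_on_Pair[OF contH continuous_on_coordinatewise_then_product])
      (rule continuous_on_sum[OF Ma])
  have C: "compact C"
    unfolding C_def by (rule compact_UN) (auto intro: compact_continuous_image b K(2))
  have "b u W z \<in> vecs d \<times> vecs d'" if "z \<in> K" for u W z
    using H[OF that] a_vecs[OF that] M by (force simp: b_def vecs_def[of d'] intro: sum.neutral)
  then have C_vecs: "C \<subseteq> vecs d \<times> vecs d'"
    unfolding C_def by blast
  \<comment> \<open>The exact messages, already known to be approximable, are the coordinates here,
    so \<open>C\<close> has to contain exact values only and no perturbed ones.\<close>
  have "approximable n (1 + l + d) enc S (\<lambda>x i j. U (b i (nbrs n (fst x) i) (snd x)) k)"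
  proof (rule approximable_continuous[where B = C and P = Q])
    show "compact C" by (rule C)
    show "continuous_on C (\<lambda>z. U z k)"
      by (rule continuous_on_product_then_coordinatewise[OF continuous_on_subset[OF contU C_vecs]])
    show "finite Q" by (simp add: Q_def)
    show "continuous_on C \<pi>" if "\<pi> \<in> Q" for \<pi>
    proof -
      have "continuous_on C (\<lambda>z. fst z t)" "continuous_on C (\<lambda>z. snd z t)" for t
        by (rule continuous_on_product_then_coordinatewise,
            intro continuous_on_fst continuous_on_snd continuous_on_id)+
      then show ?thesis
        using that unfolding Q_def by blast
    qed
    show "x = y" if x: "x \<in> C" and y: "y \<in> C" and eq: "\<And>\<pi>. \<pi> \<in> Q \<Longrightarrow> \<pi> x = \<pi> y" for x y
    proof -
      have "fst x = fst y"
      proof (rule vecs_eqI[of _ d])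
        show "fst x t = fst y t" if "t < d" for t
          by (rule eq[of "\<lambda>z. fst z t"]) (use that in \<open>simp add: Q_def\<close>)
      qed (use x y C_vecs in auto)
      moreover have "snd x = snd y"
      proof (rule vecs_eqI[of _ d'])
        show "snd x t = snd y t" if "t < d'" for t
          by (rule eq[of "\<lambda>z. snd z t"]) (use that in \<open>simp add: Q_def\<close>)
      qed (use x y C_vecs in auto)
      ultimately show ?thesis by (simp add: prod_eq_iff)
    qed
    show "b i (nbrs n (fst x) i) (snd x) \<in> C" if "x \<in> S" "i < n" "j < n" for x i j
      using S_K[OF that] that(2) unfolding C_def
      by (intro UN_I[of "(i, nbrs n (fst x) i)"]) (auto simp: nbrs_def)
    show "approximable n (1 + l + d) enc S (\<lambda>x i j. \<pi> (b i (nbrs n (fst x) i) (snd x)))"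
      if "\<pi> \<in> Q" for \<pi>
      using that H_row message_approx unfolding Q_def b_def a_def message_def by auto
  qed
  then have "approximable n (1 + l + d) enc S
      (\<lambda>x i j. mp_layer n M U (fst x) (snd (snd x)) (fst (snd x)) i k)"
    by (rule approximable_cong) (simp add: mp_layer_def b_def a_def message_def)
  then show ?thesis
    by (simp add: enc_def S_def)
qed

theorem theorem4:
  fixes n d l d' d'' :: nat
    and M :: "(nat \<Rightarrow> real) \<times> (nat \<Rightarrow> real) \<times> (nat \<Rightarrow> real) \<Rightarrow> (nat \<Rightarrow> real)"
    and U :: "(nat \<Rightarrow> real) \<times> (nat \<Rightarrow> real) \<Rightarrow> (nat \<Rightarrow> real)"
    and K :: "((nat \<Rightarrow> nat \<Rightarrow> real) \<times> (nat \<Rightarrow> nat \<Rightarrow> nat \<Rightarrow> real)) set"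
    and \<epsilon> :: real
  assumes "n \<ge> 1" "d \<ge> 1" "l \<ge> 1" "d' \<ge> 1" "d'' \<ge> 1"
    and "M \<in> vecs d \<times> vecs d \<times> vecs l \<rightarrow> vecs d'"
    and "continuous_on (vecs d \<times> vecs d \<times> vecs l) M"
    and "U \<in> vecs d \<times> vecs d' \<rightarrow> vecs d''"
    and "continuous_on (vecs d \<times> vecs d') U"
    and "K \<subseteq> mats n d \<times> tensors n l"
    and "compact K"
    and "\<epsilon> > 0"
  shows "\<exists>F. equivariant_network n (1 + l + d) (1 + l + d'') F \<and>
    (\<forall>(H, E)\<in>K. \<forall>A. (\<forall>u<n. \<forall>v<n. A u v \<in> {0, 1}) \<longrightarrow>
      max_norm n (1 + l + d'')
        (\<lambda>i j s. F (encoding n l d A E H) i j s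
               - encoding n l d'' A E (mp_layer n M U A E H) i j s) \<le> \<epsilon>)"
proof -
  define S where "S = {A :: nat \<Rightarrow> nat \<Rightarrow> real. \<forall>u<n. \<forall>v<n. A u v \<in> {0, 1}} \<times> K"
  have "\<exists>g. computable n (1 + l + d) g \<and> (\<forall>x\<in>S. \<forall>i<n. \<forall>j<n.
      \<bar>mp_layer n M U (fst x) (snd (snd x)) (fst (snd x)) i k
        - g (case x of (A, H, E) \<Rightarrow> encoding n l d A E H) i j\<bar> \<le> \<epsilon>)" for k
    using mp_layer_approximable[OF assms(6,7,9,10,11), of k] \<open>\<epsilon> > 0\<close>
    unfolding approximable_def S_def by blast
  then obtain g where g: "\<And>k. computable n (1 + l + d) (g k)"
    and g_close: "\<And>k x i j. x \<in> S \<Longrightarrow> i < n \<Longrightarrow> j < n \<Longrightarrow>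
      \<bar>mp_layer n M U (fst x) (snd (snd x)) (fst (snd x)) i k
        - g k (case x of (A, H, E) \<Rightarrow> encoding n l d A E H) i j\<bar> \<le> \<epsilon>"
    by metis
  \<comment> \<open>A single network holds all \<open>d''\<close> approximants, at positions
    \<open>\<kappa> k\<close>, and still holds the input.\<close>
  obtain b F \<kappa> where F: "retaining_network n (1 + l + d) b F"
    and \<kappa>: "\<And>k X i j. k < d'' \<Longrightarrow> i < n \<Longrightarrow> j < n \<Longrightarrow> F X i j (\<kappa> k) = g k X i j"
    using computable_family[of d'' n "1 + l + d" g, OF g] by blast
  \<comment> \<open>The approximants take values at all pairs of nodes, whereas the encoding has
    node features on the diagonal only; hence the restriction.\<close>
  define L where "L = affine_layer n (1 + l + d'') (\<lambda>s. 0) (\<lambda>s. if s < 1 + l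
    then \<lambda>X i j. X i j s else (\<lambda>X i j. if i = j then X i j (\<kappa> (s - (1 + l))) else 0))"
  have "equivariant_layer n b (1 + l + d'') L"
    unfolding L_def
    by (intro equivariant_layer_affine_layer)
      (simp add: equivariant_linear_entry equivariant_linear_diagonal)
  then have net: "equivariant_network n (1 + l + d) (1 + l + d'') (L \<circ> F)"
    using F equivariant_network_layer_comp unfolding retaining_network_def by blast
  have "max_norm n (1 + l + d'')
        (\<lambda>i j s. (L \<circ> F) (encoding n l d A E H) i j s
               - encoding n l d'' A E (mp_layer n M U A E H) i j s) \<le> \<epsilon>"
    if HE: "(H, E) \<in> K" and A: "\<forall>u<n. \<forall>v<n. A u v \<in> {0, 1}" for H E A
  proof -
    let ?X = "encoding n l d A E H" and ?Y = "encoding n l d'' A E (mp_layer n M U A E H)"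
    have "\<bar>(L \<circ> F) ?X i j s - ?Y i j s\<bar> \<le> \<epsilon>" if ij: "i < n" "j < n" and s: "s < 1 + l + d''" for i j s
    proof (cases "s < 1 + l")
      case True
      \<comment> \<open>The adjacency and edge channels are reproduced without error.\<close>
      then have "(L \<circ> F) ?X i j s = ?X i j s"
        using F ij by (simp add: L_def affine_layer_def retaining_network_def)
      also have "\<dots> = ?Y i j s"
        using True ij by (simp add: encoding_def)
      finally show ?thesis using \<open>\<epsilon> > 0\<close> by simp
    next
      case False
      define k where "k = s - (1 + l)"
      have k: "k < d''" using False s by (simp add: k_def)
      \<comment> \<open>Off the diagonal both tensors vanish; on it the error is that of
        \<open>g k\<close>.\<close>
      have "(L \<circ> F) ?X i j s = (if i = j then g k ?X i j else 0)"
        using False ij s \<kappa>[OF k] by (simp add: L_def affine_layer_def k_def)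
      moreover have "?Y i j s = (if i = j then mp_layer n M U A E H i k else 0)"
        using False ij s by (simp add: encoding_def k_def)
      moreover have "\<bar>mp_layer n M U A E H i k - g k ?X i j\<bar> \<le> \<epsilon>"
        using g_close[of "(A, H, E)" i j k] HE A ij by (simp add: S_def)
      ultimately show ?thesis
        using \<open>\<epsilon> > 0\<close> by (cases "i = j") (simp_all add: abs_minus_commute)
    qed
    \<comment> \<open>By \<open>n \<ge> 1\<close> the maximum is taken over a nonempty set.\<close>
    then show ?thesis
      using \<open>n \<ge> 1\<close> unfolding max_norm_def by (subst Max_le_iff) (auto simp: lessThan_empty_iff)
  qed
  then show ?thesis
    using net by blast
qed

end
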